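(* Let $T\subset\mathbb{R}^2$ be a nondegenerate triangle and let $\gamma>-1$ with $\gamma\neq 0$. Then the linear functionals $$\mathcal{F}_{j,\gamma}^{\mathrm{enr}}(f)=\int_0^1 t^{\gamma}(1-t)^{\gamma} f\left(t\boldsymbol{m}_{j+1}+(1-t)\boldsymbol{m}_{j+2}\right)dt,\qquad f\in C(T),\ j=1,2,3,$$ are admissible, i.e. the $3\times3$ matrix $N=\left[\mathcal{F}_{j,\gamma}^{\mathrm{enr}}(\varphi_i)\right]_{j,i=1,2,3}$ satisfies $\det(N)\neq 0$.
   Context: $T$ has vertices $\boldsymbol{v}_1,\boldsymbol{v}_2,\boldsymbol{v}_3$ (oriented counterclockwise) and barycentric coordinates $\lambda_1,\lambda_2,\lambda_3$. The edge midpoints are $\boldsymbol{m}_1=\frac{\boldsymbol{v}_2+\boldsymbol{v}_3}{2}$, $\boldsymbol{m}_2=\frac{\boldsymbol{v}_3+\boldsymbol{v}_1}{2}$, $\boldsymbol{m}_3=\frac{\boldsymbol{v}_1+\boldsymbol{v}_2}{2}$, with the convention $\boldsymbol{m}_4=\boldsymbol{m}_1$, $\boldsymbol{m}_5=\boldsymbol{m}_2$. $C(T)$ is the space of continuous real functions on $T$. The functions $\varphi_i$ are $$\varphi_1=\lambda_1(1-3\lambda_2-3\lambda_3),\quad \varphi_2=\lambda_2(1-3\lambda_1-3\lambda_3),\quad \varphi_3=\lambda_3(1-3\lambda_1-3\lambda_2).$$ In $N$, $j$ is the row index and $i$ the column index. *)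

theory Defs
  imports "HOL-Analysis.Analysis"
begin

text \<open>
  Vertices are indexed by the three-element type \<^typ>\<open>3\<close>, whose arithmetic is modulo 3. In it the
  numerals \<open>4\<close> and \<open>5\<close> denote \<open>1\<close> and \<open>2\<close> (and \<open>3\<close> denotes \<open>0\<close>), so that the cyclic conventions
  \<open>m\<^sub>4 = m\<^sub>1\<close> and \<open>m\<^sub>5 = m\<^sub>2\<close> hold automatically.
\<close>

definition triangle :: "(3 \<Rightarrow> real^2) \<Rightarrow> (real^2) set" where
  "triangle v = convex hull {v 1, v 2, v 3}"

definition nondegenerate :: "(3 \<Rightarrow> real^2) \<Rightarrow> bool" where
  "nondegenerate v \<longleftrightarrow> \<not> collinear {v 1, v 2, v 3}"

text \<open>Twice the signed area of the triangle is positive.\<close>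

definition counterclockwise :: "(3 \<Rightarrow> real^2) \<Rightarrow> bool" where
  "counterclockwise v \<longleftrightarrow>
     (v 2 - v 1) $ 1 * (v 3 - v 1) $ 2 - (v 2 - v 1) $ 2 * (v 3 - v 1) $ 1 > 0"

text \<open>Well defined on the whole plane for nondegenerate \<open>v\<close>; see \<open>barycentric_unique\<close> below.\<close>

definition barycentric :: "(3 \<Rightarrow> real^2) \<Rightarrow> 3 \<Rightarrow> real^2 \<Rightarrow> real" where
  "barycentric v i x =
     (THE l :: real^3. (\<Sum>k\<in>UNIV. l $ k) = 1 \<and> (\<Sum>k\<in>UNIV. (l $ k) *\<^sub>R v k) = x) $ i"

definition edge_midpoint :: "(3 \<Rightarrow> real^2) \<Rightarrow> 3 \<Rightarrow> real^2" where
  "edge_midpoint v i = midpoint (v (i + 1)) (v (i + 2))"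

definition enr_basis :: "(3 \<Rightarrow> real^2) \<Rightarrow> 3 \<Rightarrow> real^2 \<Rightarrow> real" where
  "enr_basis v i x =
     barycentric v i x * (1 - 3 * barycentric v (i + 1) x - 3 * barycentric v (i + 2) x)"

text \<open>
  Functions in \<open>C(T)\<close> are represented by total functions that are continuous on \<open>T\<close>; only the values
  on \<open>T\<close> matter. At the endpoints the weight may be singular in the mathematics while
  \<^term>\<open>0 powr \<gamma> = 0\<close>, which does not affect the integral.
\<close>

definition enr_functional ::
  "(3 \<Rightarrow> real^2) \<Rightarrow> 3 \<Rightarrow> real \<Rightarrow> (real^2 \<Rightarrow> real) \<Rightarrow> real" where
  "enr_functional v j \<gamma> f =
     integral {0..1} (\<lambda>t. t powr \<gamma> * (1 - t) powr \<gamma> *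
       f (t *\<^sub>R edge_midpoint v (j + 1) + (1 - t) *\<^sub>R edge_midpoint v (j + 2)))"

text \<open>The matrix \<open>N\<close>, with row index \<open>j\<close> (functional) and column index \<open>i\<close> (function).\<close>

definition enr_matrix :: "(3 \<Rightarrow> real^2) \<Rightarrow> (3 \<Rightarrow> (real^2 \<Rightarrow> real) \<Rightarrow> real) \<Rightarrow> real^3^3" where
  "enr_matrix v F = (\<chi> j i. F j (enr_basis v i))"

definition admissible :: "(3 \<Rightarrow> real^2) \<Rightarrow> (3 \<Rightarrow> (real^2 \<Rightarrow> real) \<Rightarrow> real) \<Rightarrow> bool" where
  "admissible v F \<longleftrightarrow> det (enr_matrix v F) \<noteq> 0"


subsection \<open>Well-definedness\<close>

lemma numeral_3_mod:
  "(4 :: 3) = 1" "(5 :: 3) = 2" "(6 :: 3) = 3" "(7 :: 3) = 1"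
proof -
  have z: "(3 :: 3) = 0" by simp
  have "(4 :: 3) = 3 + 1" "(5 :: 3) = 3 + 2" "(6 :: 3) = 3 + 3" "(7 :: 3) = 3 + 3 + 1"
    by simp_all
  then show "(4 :: 3) = 1" "(5 :: 3) = 2" "(6 :: 3) = 3" "(7 :: 3) = 1"
    by (simp_all only: z add_0)
qed

lemma edge_midpoint_eqs:
  "edge_midpoint v 1 = midpoint (v 2) (v 3)"
  "edge_midpoint v 2 = midpoint (v 3) (v 1)"
  "edge_midpoint v 3 = midpoint (v 1) (v 2)"
  "edge_midpoint v 4 = edge_midpoint v 1"
  "edge_midpoint v 5 = edge_midpoint v 2"
  by (simp_all add: edge_midpoint_def numeral_3_mod)

lemma enr_basis_eqs:
  "enr_basis v 1 x = barycentric v 1 x * (1 - 3 * barycentric v 2 x - 3 * barycentric v 3 x)"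
  "enr_basis v 2 x = barycentric v 2 x * (1 - 3 * barycentric v 1 x - 3 * barycentric v 3 x)"
  "enr_basis v 3 x = barycentric v 3 x * (1 - 3 * barycentric v 1 x - 3 * barycentric v 2 x)"
  by (simp_all add: enr_basis_def numeral_3_mod algebra_simps)

lemma signed_area_nonzero:
  assumes "nondegenerate v"
  shows "(v 2 - v 1) $ 1 * (v 3 - v 1) $ 2 - (v 2 - v 1) $ 2 * (v 3 - v 1) $ 1 \<noteq> 0"
proof
  define a b where "a = v 2 - v 1" and "b = v 3 - v 1"
  assume "(v 2 - v 1) $ 1 * (v 3 - v 1) $ 2 - (v 2 - v 1) $ 2 * (v 3 - v 1) $ 1 = 0"
  then have D: "a $ 1 * b $ 2 = a $ 2 * b $ 1" by (simp add: a_def b_def)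
  have "collinear {0, a, b}"
  proof (cases "a = 0")
    case False
    then consider "a $ 1 \<noteq> 0" | "a $ 2 \<noteq> 0" by (auto simp: vec_eq_iff forall_2)
    then have "\<exists>c. b = c *\<^sub>R a"
    proof cases
      case 1
      then have "b = (b $ 1 / a $ 1) *\<^sub>R a" using D by (simp add: vec_eq_iff forall_2 field_simps)
      then show ?thesis by blast
    next
      case 2
      then have "b = (b $ 2 / a $ 2) *\<^sub>R a" using D by (simp add: vec_eq_iff forall_2 field_simps)
      then show ?thesis by blast
    qed
    then show ?thesis by (simp add: collinear_lemma)
  qed (simp add: collinear_lemma)
  then have "collinear {v 2, v 1, v 3}"
    by (simp add: collinear_3[of "v 2" "v 1" "v 3"] a_def b_def)
  then show False using assms by (simp add: nondegenerate_def insert_commute)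
qed

lemma counterclockwise_imp_nondegenerate:
  assumes "counterclockwise v"
  shows "nondegenerate v"
proof (rule ccontr)
  assume "\<not> nondegenerate v"
  then have "collinear {v 2, v 1, v 3}" by (simp add: nondegenerate_def insert_commute)
  then have "collinear {0, v 2 - v 1, v 3 - v 1}" by (simp add: collinear_3[of "v 2" "v 1" "v 3"])
  then show False using assms
    by (auto simp: collinear_lemma counterclockwise_def simp del: vector_minus_component)
qed

lemma barycentric_ex1:
  assumes "nondegenerate v"
  shows "\<exists>!l :: real^3. (\<Sum>k\<in>UNIV. l $ k) = 1 \<and> (\<Sum>k\<in>UNIV. (l $ k) *\<^sub>R v k) = x"
proof -
  define p q r s D where "p = (v 2 - v 1) $ 1" and "q = (v 2 - v 1) $ 2"
    and "r = (v 3 - v 1) $ 1" and "s = (v 3 - v 1) $ 2" and "D = p * s - q * r"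
  define y z where "y = (x - v 1) $ 1" and "z = (x - v 1) $ 2"
  have D: "D \<noteq> 0" using signed_area_nonzero[OF assms] by (simp add: D_def p_def q_def r_def s_def)
  have iff: "((\<Sum>k\<in>UNIV. l $ k) = 1 \<and> (\<Sum>k\<in>UNIV. (l $ k) *\<^sub>R v k) = x) \<longleftrightarrow>
      l $ 1 = 1 - l $ 2 - l $ 3 \<and> l $ 2 * p + l $ 3 * r = y \<and> l $ 2 * q + l $ 3 * s = z"
    for l :: "real^3"
  proof -
    have "(\<Sum>k\<in>UNIV. l $ k) = 1 \<longleftrightarrow> l $ 1 = 1 - l $ 2 - l $ 3" by (auto simp: sum_3)
    moreover have "(\<Sum>k\<in>UNIV. (l $ k) *\<^sub>R v k) = x \<longleftrightarrow>
        l $ 2 * p + l $ 3 * r = y \<and> l $ 2 * q + l $ 3 * s = z" if "l $ 1 = 1 - l $ 2 - l $ 3"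
      unfolding sum_3 that
      by (auto simp: vec_eq_iff forall_2 p_def q_def r_def s_def y_def z_def algebra_simps)
    ultimately show ?thesis by blast
  qed
  have solve: "(b * p + c * r = y \<and> b * q + c * s = z) \<longleftrightarrow>
      (b = (y * s - z * r) / D \<and> c = (p * z - q * y) / D)" for b c :: real
  proof
    assume h: "b * p + c * r = y \<and> b * q + c * s = z"
    have "b * D = y * s - z * r" "c * D = p * z - q * y"
      unfolding D_def using h by (auto simp: algebra_simps)
    then show "b = (y * s - z * r) / D \<and> c = (p * z - q * y) / D" using D by (simp add: field_simps)
  next
    assume h: "b = (y * s - z * r) / D \<and> c = (p * z - q * y) / D"
    then have "b * D = y * s - z * r" "c * D = p * z - q * y" using D by auto
    then have "(b * p + c * r) * D = y * D" "(b * q + c * s) * D = z * D"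
      unfolding D_def by algebra+
    then show "b * p + c * r = y \<and> b * q + c * s = z" using D by simp
  qed
  define b c where "b = (y * s - z * r) / D" and "c = (p * z - q * y) / D"
  show ?thesis
    unfolding iff solve b_def[symmetric] c_def[symmetric]
  proof (rule ex1I)
    let ?w = "vector [1 - b - c, b, c] :: real^3"
    show "?w $ 1 = 1 - ?w $ 2 - ?w $ 3 \<and> ?w $ 2 = b \<and> ?w $ 3 = c"
      by (simp add: vector_3)
  qed (auto simp: vec_eq_iff forall_3 vector_3)
qed

lemma barycentric_unique:
  assumes "nondegenerate v" and "(\<Sum>k\<in>UNIV. l k) = 1" and "(\<Sum>k\<in>UNIV. l k *\<^sub>R v k) = x"
  shows "barycentric v i x = l i"
proof -
  have "(THE l :: real^3. (\<Sum>k\<in>UNIV. l $ k) = 1 \<and> (\<Sum>k\<in>UNIV. (l $ k) *\<^sub>R v k) = x) = (\<chi> k. l k)"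
    by (rule the1_equality[OF barycentric_ex1[OF assms(1)]]) (simp add: assms)
  then show ?thesis by (simp add: barycentric_def)
qed

lemma edge_midpoint_in_triangle: "edge_midpoint v i \<in> triangle v"
proof -
  have v: "v k \<in> triangle v" for k
    unfolding triangle_def using exhaust_3[of k] by (auto intro: hull_inc)
  have "midpoint (v a) (v b) \<in> triangle v" for a b
    using convexD[OF convex_convex_hull v[unfolded triangle_def, of a] v[unfolded triangle_def, of b],
        of "1/2" "1/2"]
    by (simp add: midpoint_def triangle_def scaleR_add_right)
  then show ?thesis by (simp add: edge_midpoint_def)
qed

lemma segment_in_triangle:
  assumes "t \<in> {0..1}"
  shows "t *\<^sub>R edge_midpoint v i + (1 - t) *\<^sub>R edge_midpoint v j \<in> triangle v"
  using convexD[OF convex_convex_hull edge_midpoint_in_triangle[unfolded triangle_def, of v i]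
      edge_midpoint_in_triangle[unfolded triangle_def, of v j], of t "1 - t"] assms
  by (simp add: triangle_def)

lemma enr_functional_absolutely_integrable:
  assumes "\<gamma> > -1" and "continuous_on (triangle v) f"
  shows "(\<lambda>t. t powr \<gamma> * (1 - t) powr \<gamma> *
       f (t *\<^sub>R edge_midpoint v (j + 1) + (1 - t) *\<^sub>R edge_midpoint v (j + 2)))
     absolutely_integrable_on {0..1}"
proof -
  define g where "g = (\<lambda>t. f (t *\<^sub>R edge_midpoint v (j + 1) + (1 - t) *\<^sub>R edge_midpoint v (j + 2)))"
  have g: "continuous_on {0..1} g"
    unfolding g_def
    by (rule continuous_on_compose2[OF assms(2)])
       (use segment_in_triangle in \<open>auto intro!: continuous_intros\<close>)
  have "(\<lambda>t. t powr \<gamma> * (1 - t) powr \<gamma>) integrable_on {0..1}"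
    using has_integral_Beta_real[of "\<gamma> + 1" "\<gamma> + 1"] assms(1) by (auto simp: integrable_on_def)
  then have w: "(\<lambda>t. t powr \<gamma> * (1 - t) powr \<gamma>) absolutely_integrable_on {0..1}"
    by (rule nonnegative_absolutely_integrable_1) auto
  have "(\<lambda>t. g t * (t powr \<gamma> * (1 - t) powr \<gamma>)) absolutely_integrable_on {0..1}"
  proof (rule absolutely_integrable_bounded_measurable_product_real)
    show "g \<in> borel_measurable (lebesgue_on {0..1})"
      by (rule continuous_imp_measurable_on_sets_lebesgue[OF g]) simp
    show "bounded (g ` {0..1})"
      by (rule compact_imp_bounded[OF compact_continuous_image[OF g]]) simp
  qed (use w in auto)
  then show ?thesis by (simp add: g_def mult.commute)
qed

lemma enr_functional_linear:
  assumes "\<gamma> > -1" and "continuous_on (triangle v) f" and "continuous_on (triangle v) g"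
  shows "enr_functional v j \<gamma> (\<lambda>x. a * f x + b * g x) =
    a * enr_functional v j \<gamma> f + b * enr_functional v j \<gamma> g"
proof -
  have I: "(\<lambda>t. t powr \<gamma> * (1 - t) powr \<gamma> *
       h (t *\<^sub>R edge_midpoint v (j + 1) + (1 - t) *\<^sub>R edge_midpoint v (j + 2))) integrable_on {0..1}"
    if "continuous_on (triangle v) h" for h
    using enr_functional_absolutely_integrable[OF assms(1) that]
    by (rule set_lebesgue_integral_eq_integral(1))
  have "((\<lambda>t. a * (t powr \<gamma> * (1 - t) powr \<gamma> *
         f (t *\<^sub>R edge_midpoint v (j + 1) + (1 - t) *\<^sub>R edge_midpoint v (j + 2))) +
       b * (t powr \<gamma> * (1 - t) powr \<gamma> *
         g (t *\<^sub>R edge_midpoint v (j + 1) + (1 - t) *\<^sub>R edge_midpoint v (j + 2))))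
     has_integral a * enr_functional v j \<gamma> f + b * enr_functional v j \<gamma> g) {0..1}"
    unfolding enr_functional_def
    by (intro has_integral_add has_integral_mult_right integrable_integral I assms)
  then show ?thesis
    unfolding enr_functional_def[of v j \<gamma> "\<lambda>x. a * f x + b * g x"]
    by (intro integral_unique) (simp add: algebra_simps)
qed

end

theory Submission
  imports Defs
begin

text \<open>
  On the segment of the \<open>j\<close>-th functional, \<open>\<lambda>\<^sub>j = 1/2\<close> while the other two coordinates are
  \<open>t/2\<close> and \<open>(1 - t)/2\<close>, and \<open>\<phi>\<^sub>i = \<lambda>\<^sub>i (3 \<lambda>\<^sub>i - 2)\<close>. As the weight is symmetric under
  \<open>t \<mapsto> 1 - t\<close>, the matrix \<open>N\<close> has one constant \<open>d\<close> on the diagonal and one constant \<open>c\<close> off it, so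
  \<open>det N = (d - c)\<^sup>2 (d + 2 c)\<close>. The moments of the weight are Beta values; with
  \<open>B = Beta (\<gamma> + 1) (\<gamma> + 1)\<close> they give \<open>d - c = B \<gamma> / (8 (2 \<gamma> + 3))\<close>, which vanishes only for
  \<open>\<gamma> = 0\<close>, and \<open>d, c < 0\<close>.
\<close>

lemma has_integral_powr_Beta_moment:
  fixes a b :: real
  assumes "a > -1" and "b > -1"
  shows "((\<lambda>t. t powr a * (1 - t) powr b * t ^ n) has_integral Beta (a + 1 + real n) (b + 1)) {0..1}"
proof -
  have "t powr a * (1 - t) powr b * t ^ n = t powr (a + real n) * (1 - t) powr b"
    if "t \<in> {0..1}" for t :: real
    \<comment> \<open>At \<open>t = 0\<close> both sides vanish, since \<open>0 powr _ = 0\<close>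
      for every exponent, even a negative one.\<close>
    using that by (cases "t = 0") (simp_all add: powr_add powr_realpow)
  moreover have "((\<lambda>t. t powr (a + real n) * (1 - t) powr b)
      has_integral Beta (a + 1 + real n) (b + 1)) {0..1}"
    using has_integral_Beta_real[of "a + 1 + real n" "b + 1"] assms by (simp add: algebra_simps)
  ultimately show ?thesis
    by (subst has_integral_cong)
qed

text \<open>The recurrence \<open>(x + y) * Beta (x + 1) y = x * Beta x y\<close>, applied once and
  twice, reduces the first and second moments to multiples of the zeroth.\<close>

lemma integral_symmetric_Beta_weight_quadratic:
  fixes \<gamma> a b c :: real
  assumes "\<gamma> > -1"
  shows "integral {0..1} (\<lambda>t. t powr \<gamma> * (1 - t) powr \<gamma> * (a + b * t + c * t\<^sup>2)) =
    (a + b / 2 + c * (\<gamma> + 2) / (2 * (2 * \<gamma> + 3))) * Beta (\<gamma> + 1) (\<gamma> + 1)"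
proof (rule integral_unique)
  let ?B = "Beta (\<gamma> + 1) (\<gamma> + 1)"
  have "\<gamma> + 1 \<notin> \<int>\<^sub>\<le>\<^sub>0" "\<gamma> + 2 \<notin> \<int>\<^sub>\<le>\<^sub>0"
    using assms by (auto dest: nonpos_Ints_nonpos)
  note plus1 = this[THEN Beta_plus1_left, of "\<gamma> + 1"]
  have "(2 * \<gamma> + 2) * Beta (\<gamma> + 2) (\<gamma> + 1) = (\<gamma> + 1) * ?B"
    using plus1(1) by (simp add: add.assoc)
  then have "(\<gamma> + 1) * (2 * Beta (\<gamma> + 2) (\<gamma> + 1)) = (\<gamma> + 1) * ?B"
    by (simp add: algebra_simps)
  then have B1: "Beta (\<gamma> + 2) (\<gamma> + 1) = ?B / 2"
    using assms by simp
  have "(2 * \<gamma> + 3) * Beta (\<gamma> + 3) (\<gamma> + 1) = (\<gamma> + 2) * Beta (\<gamma> + 2) (\<gamma> + 1)"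
    using plus1(2) by (simp add: add.assoc)
  then have B2: "Beta (\<gamma> + 3) (\<gamma> + 1) = (\<gamma> + 2) * ?B / (2 * (2 * \<gamma> + 3))"
    unfolding B1 using assms by (simp add: field_simps)
  let ?w = "\<lambda>t. t powr \<gamma> * (1 - t) powr \<gamma>"
  note moment = has_integral_powr_Beta_moment[OF assms assms]
  have "((\<lambda>t. a * (?w t * t ^ 0) + b * (?w t * t ^ 1) + c * (?w t * t ^ 2)) has_integral
      a * Beta (\<gamma> + 1 + real 0) (\<gamma> + 1) + b * Beta (\<gamma> + 1 + real 1) (\<gamma> + 1) +
      c * Beta (\<gamma> + 1 + real 2) (\<gamma> + 1)) {0..1}"
    by (intro has_integral_add has_integral_mult_right moment)
  also have "(\<lambda>t. a * (?w t * t ^ 0) + b * (?w t * t ^ 1) + c * (?w t * t ^ 2)) =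
      (\<lambda>t. ?w t * (a + b * t + c * t\<^sup>2))"
    by (simp add: algebra_simps)
  also have "a * Beta (\<gamma> + 1 + real 0) (\<gamma> + 1) + b * Beta (\<gamma> + 1 + real 1) (\<gamma> + 1) +
      c * Beta (\<gamma> + 1 + real 2) (\<gamma> + 1) =
      (a + b / 2 + c * (\<gamma> + 2) / (2 * (2 * \<gamma> + 3))) * ?B"
    by (simp add: add.assoc B1 B2) (simp add: algebra_simps)
  finally show "((\<lambda>t. ?w t * (a + b * t + c * t\<^sup>2)) has_integral
      (a + b / 2 + c * (\<gamma> + 2) / (2 * (2 * \<gamma> + 3))) * ?B) {0..1}" .
qed

text \<open>Indices are modulo 3, so both midpoints lie on edges through \<open>v j\<close> and each
  gives it weight 1/2; the remaining halves go to \<open>v (j + 2)\<close> and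
  \<open>v (j + 1)\<close>.\<close>

lemma barycentric_midpoint_segment:
  assumes "nondegenerate v"
  shows "barycentric v i (t *\<^sub>R edge_midpoint v (j + 1) + (1 - t) *\<^sub>R edge_midpoint v (j + 2)) =
    (if i = j then 1 / 2 else if i = j + 1 then (1 - t) / 2 else t / 2)"
proof (rule barycentric_unique[OF assms])
  let ?l = "\<lambda>k. if k = j then 1 / 2 else if k = j + 1 then (1 - t) / 2 else t / 2"
  show "(\<Sum>k\<in>UNIV. ?l k) = 1"
    using exhaust_3[of j] by (auto simp: sum_3 field_simps)
  show "(\<Sum>k\<in>UNIV. ?l k *\<^sub>R v k) =
      t *\<^sub>R edge_midpoint v (j + 1) + (1 - t) *\<^sub>R edge_midpoint v (j + 2)"
    using exhaust_3[of j]
    by (auto simp: sum_3 edge_midpoint_def numeral_3_mod midpoint_def vec_eq_iff field_simps)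
qed

lemma sum_barycentric:
  assumes "nondegenerate v"
  shows "(\<Sum>i\<in>UNIV. barycentric v i x) = 1"
  using theI'[OF barycentric_ex1[OF assms, of x]] by (simp add: barycentric_def)

lemma enr_basis_eq:
  assumes "nondegenerate v"
  shows "enr_basis v i x = barycentric v i x * (3 * barycentric v i x - 2)"
proof -
  have "barycentric v i x + barycentric v (i + 1) x + barycentric v (i + 2) x = 1"
    using sum_barycentric[OF assms, of x] exhaust_3[of i] by (auto simp: sum_3 numeral_3_mod)
  then have "1 - 3 * barycentric v (i + 1) x - 3 * barycentric v (i + 2) x =
      3 * barycentric v i x - 2"
    by linarith
  then show ?thesis by (simp add: enr_basis_def)
qed

lemma enr_functional_enr_basis:
  assumes "nondegenerate v" and "\<gamma> > -1"
  shows "enr_functional v j \<gamma> (enr_basis v i) =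
    (if i = j then - 1 / 4 else - (5 * \<gamma> + 6) / (8 * (2 * \<gamma> + 3))) * Beta (\<gamma> + 1) (\<gamma> + 1)"
proof -
  \<comment> \<open>Coefficients of s (3 s - 2) in powers of t, for s = 1/2, (1 - t)/2 and
    t/2.\<close>
  define a b c :: real where "a = (if i = j then - 1 / 4 else if i = j + 1 then - 1 / 4 else 0)"
    and "b = (if i = j then 0 else if i = j + 1 then - 1 / 2 else - 1)"
    and "c = (if i = j then 0 else 3 / 4)"
  have "enr_functional v j \<gamma> (enr_basis v i) =
      integral {0..1} (\<lambda>t. t powr \<gamma> * (1 - t) powr \<gamma> * (a + b * t + c * t\<^sup>2))"
    unfolding enr_functional_def enr_basis_eq[OF assms(1)]
      barycentric_midpoint_segment[OF assms(1)]
    by (intro integral_cong arg_cong2[where f = "(*)"] refl)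
      (simp add: a_def b_def c_def field_simps power2_eq_square)
  also have "\<dots> = (a + b / 2 + c * (\<gamma> + 2) / (2 * (2 * \<gamma> + 3))) * Beta (\<gamma> + 1) (\<gamma> + 1)"
    by (rule integral_symmetric_Beta_weight_quadratic[OF assms(2)])
  \<comment> \<open>The two off-diagonal cases merge here: \<open>a + b / 2\<close> is -1/2 in
    both.\<close>
  also have "a + b / 2 + c * (\<gamma> + 2) / (2 * (2 * \<gamma> + 3)) =
      (if i = j then - 1 / 4 else - (5 * \<gamma> + 6) / (8 * (2 * \<gamma> + 3)))"
  proof -
    have "2 * \<gamma> + 3 \<noteq> 0" using assms(2) by simp
    then show ?thesis by (simp add: a_def b_def c_def divide_simps) (simp add: algebra_simps)
  qed
  finally show ?thesis .
qed

text \<open>The matrix is (d - c) I + c J with J the all-ones matrix, whose eigenvalues over the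
  reals are 3, 0, 0.\<close>

lemma det_constant_off_diagonal_3:
  fixes c d :: "'a::comm_ring_1"
  shows "det (\<chi> j i. if i = j then d else c :: 'a^3^3) = (d - c)\<^sup>2 * (d + 2 * c)"
  by (simp add: det_3 power2_eq_square algebra_simps)

theorem theorem3p1:
  fixes v :: "3 \<Rightarrow> real^2" and \<gamma> :: real
  assumes "nondegenerate v" and "counterclockwise v"
    and "\<gamma> > -1" and "\<gamma> \<noteq> 0"
  shows "admissible v (\<lambda>j. enr_functional v j \<gamma>)"
proof -
  define B where "B = Beta (\<gamma> + 1) (\<gamma> + 1)"
  define d c where "d = - 1 / 4 * B" and "c = - (5 * \<gamma> + 6) / (8 * (2 * \<gamma> + 3)) * B"
  have B: "B > 0"
    using assms(3) by (auto simp: B_def Beta_def intro!: divide_pos_pos mult_pos_pos Gamma_real_pos)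
  have "enr_matrix v (\<lambda>j. enr_functional v j \<gamma>) = (\<chi> j i. if i = j then d else c)"
    unfolding enr_matrix_def enr_functional_enr_basis[OF assms(1,3)] d_def c_def B_def
    by (simp add: vec_eq_iff)
  then have det: "det (enr_matrix v (\<lambda>j. enr_functional v j \<gamma>)) = (d - c)\<^sup>2 * (d + 2 * c)"
    by (simp add: det_constant_off_diagonal_3)
  have "d - c = B * \<gamma> / (8 * (2 * \<gamma> + 3))"
    using assms(3) by (simp add: d_def c_def field_simps)
  then have "d - c \<noteq> 0"
    using B assms(3,4) by simp
  moreover have "d < 0"
    using B by (simp add: d_def)
  \<comment> \<open>From \<gamma> > -1, both 5 \<gamma> + 6 and 2 \<gamma> + 3 exceed 1. With
    \<open>d < 0\<close> this makes the factor \<open>d + 2 * c\<close> negative.\<close>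
  moreover have "c < 0"
    unfolding c_def using B assms(3) by (intro mult_neg_pos divide_neg_pos) auto
  ultimately show ?thesis
    by (simp add: admissible_def det)
qed

end
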